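(* Let $(L,A,[\,\cdot\,,\ldots,\cdot\,],\rho)$ be an $n$-Lie--Rinehart algebra and let $B:L\times L\to A$ be a symmetric $A$-bilinear form. If $u,v\in\operatorname{Rad}(\rho)$, then $$\mathcal{O}_{B,i}(a;X)(u,v)=0$$ for every fundamental element $X=x_1\wedge\cdots\wedge x_{n-1}$ with $x_1,\ldots,x_{n-1}\in L$, every $1\le i\le n-1$ and every $a\in A$.
   Context: $K$ is a field of characteristic zero, $A$ is a commutative associative $K$-algebra, $n\ge 2$ is an integer, and $\operatorname{Der}_K(A)$ is the $A$-module of $K$-linear derivations of $A$, with commutator bracket. An $n$-Lie algebra over $K$ is a $K$-vector space $L$ with an alternating $K$-multilinear bracket $[\,\cdot\,,\ldots,\cdot\,]:L^n\to L$ satisfying the Filippov identity $[x_1,\ldots,x_{n-1},[y_1,\ldots,y_n]]=\sum_{i=1}^n[y_1,\ldots,[x_1,\ldots,x_{n-1},y_i],\ldots,y_n]$. For $X=x_1\wedge\cdots\wedge x_{n-1}$ and $Y=y_1\wedge\cdots\wedge y_{n-1}$ (fundamental elements, with chosen representatives) put $[X,z]=[x_1,\ldots,x_{n-1},z]$ and $X\circ Y=\sum_{i=1}^{n-1}y_1\wedge\cdots\wedge[X,y_i]\wedge\cdots\wedge y_{n-1}$. An $n$-Lie--Rinehart algebra over $A$ is a quadruple $(L,A,[\,\cdot\,,\ldots,\cdot\,],\rho)$ such that: (i) $L$ is an $A$-module and an $n$-Lie algebra over $K$; (ii)--(iii) $\rho:\bigwedge_A^{n-1}L\to\operatorname{Der}_K(A)$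 (the anchor), regarded as an alternating $A$-multilinear map $\rho(x_1,\ldots,x_{n-1})=\rho(x_1\wedge\cdots\wedge x_{n-1})$, satisfies $[\rho(X),\rho(Y)]=\rho(X\circ Y)$ for all fundamental elements $X,Y$; (iv) $[x_1,\ldots,x_{n-1},ay]=a[x_1,\ldots,x_{n-1},y]+\rho(x_1,\ldots,x_{n-1})(a)\,y$ for all $x_j,y\in L$, $a\in A$. The anchor radical is $\operatorname{Rad}(\rho)=\{u\in L:\rho(u,x_2,\ldots,x_{n-1})=0\ \text{for all }x_2,\ldots,x_{n-1}\in L\}$. For a symmetric $A$-bilinear form $B$ on $L$ and a fundamental element $X$, the orthogonality defect is $(D_XB)(u,v)=\rho(X)(B(u,v))-B([X,u],v)-B(u,[X,v])$ for $u,v\in L$. For $X=x_1\wedge\cdots\wedge x_{n-1}$, $1\le i\le n-1$, $a\in A$, $X_{a,i}=x_1\wedge\cdots\wedge ax_i\wedge\cdots\wedge x_{n-1}$ ($x_i$ replaced by $ax_i$, with this representative used in $[X_{a,i},u]$). Finally $\mathcal{O}_{B,i}(a;X)(u,v)=(D_{X_{a,i}}B)(u,v)-a(D_XB)(u,v)$. *)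

theory Defs
  imports "HOL-Algebra.Module"
begin

text \<open>
  Algebras and modules are those of HOL-Algebra (commutative, associative and unital algebras,
  unital modules; the zero algebra is allowed). Of the record representing a module only the
  carrier, the additive structure and the scalar multiplication are meaningful. Maps are only
  constrained on carriers.

  A map of \<open>m\<close> arguments is a function on lists, considered on lists of length \<open>m\<close> over the
  carrier. In particular a fundamental element with a chosen representative
  \<open>x\<^sub>1 \<and> \<dots> \<and> x\<^sub>n\<^sub>-\<^sub>1\<close> is the list \<open>[x\<^sub>1, \<dots>, x\<^sub>n\<^sub>-\<^sub>1]\<close>; the entry \<open>x\<^sub>i\<close> is \<open>X ! (i - 1)\<close>.
\<close>

definition char_zero :: "('k, 'm) ring_scheme \<Rightarrow> bool" where
  "char_zero K \<longleftrightarrow> (\<forall>m::nat. m > 0 \<longrightarrow> [m] \<cdot>\<^bsub>K\<^esub> \<one>\<^bsub>K\<^esub> \<noteq> \<zero>\<^bsub>K\<^esub>)"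

definition tuples :: "nat \<Rightarrow> 'a set \<Rightarrow> 'a list set" where
  "tuples m S = {xs. length xs = m \<and> set xs \<subseteq> S}"

definition alternating_multilinear ::
  "('r, 'm) ring_scheme \<Rightarrow> ('r, 'a, 'p) module_scheme \<Rightarrow> ('r, 'b, 'q) module_scheme \<Rightarrow> nat
    \<Rightarrow> ('a list \<Rightarrow> 'b) \<Rightarrow> bool" where
  "alternating_multilinear R M N m f \<longleftrightarrow>
     f \<in> tuples m (carrier M) \<rightarrow> carrier N \<and>
     (\<forall>xs \<in> tuples m (carrier M). \<forall>i < m. \<forall>x \<in> carrier M. \<forall>y \<in> carrier M.
        f (xs[i := x \<oplus>\<^bsub>M\<^esub> y]) = f (xs[i := x]) \<oplus>\<^bsub>N\<^esub> f (xs[i := y])) \<and>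
     (\<forall>xs \<in> tuples m (carrier M). \<forall>i < m. \<forall>r \<in> carrier R. \<forall>x \<in> carrier M.
        f (xs[i := r \<odot>\<^bsub>M\<^esub> x]) = r \<odot>\<^bsub>N\<^esub> f (xs[i := x])) \<and>
     (\<forall>xs \<in> tuples m (carrier M). \<forall>i < m. \<forall>j < m.
        i \<noteq> j \<and> xs ! i = xs ! j \<longrightarrow> f xs = \<zero>\<^bsub>N\<^esub>)"

definition symmetric_bilinear_form ::
  "('a, 'm) ring_scheme \<Rightarrow> ('a, 'l, 'p) module_scheme \<Rightarrow> ('l \<Rightarrow> 'l \<Rightarrow> 'a) \<Rightarrow> bool" where
  "symmetric_bilinear_form A L B \<longleftrightarrow>
     (\<forall>u \<in> carrier L. \<forall>v \<in> carrier L. B u v \<in> carrier A \<and> B u v = B v u) \<and>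
     (\<forall>u \<in> carrier L. \<forall>v \<in> carrier L. \<forall>w \<in> carrier L.
        B (u \<oplus>\<^bsub>L\<^esub> v) w = B u w \<oplus>\<^bsub>A\<^esub> B v w \<and> B w (u \<oplus>\<^bsub>L\<^esub> v) = B w u \<oplus>\<^bsub>A\<^esub> B w v) \<and>
     (\<forall>a \<in> carrier A. \<forall>u \<in> carrier L. \<forall>v \<in> carrier L.
        B (a \<odot>\<^bsub>L\<^esub> u) v = a \<otimes>\<^bsub>A\<^esub> B u v \<and> B u (a \<odot>\<^bsub>L\<^esub> v) = a \<otimes>\<^bsub>A\<^esub> B u v)"

definition derivations :: "('k, 'm) ring_scheme \<Rightarrow> ('k, 'a, 'p) module_scheme \<Rightarrow> ('a \<Rightarrow> 'a) set" where
  "derivations K A =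
     {d \<in> carrier A \<rightarrow>\<^sub>E carrier A.
        (\<forall>a \<in> carrier A. \<forall>b \<in> carrier A. d (a \<oplus>\<^bsub>A\<^esub> b) = d a \<oplus>\<^bsub>A\<^esub> d b) \<and>
        (\<forall>k \<in> carrier K. \<forall>a \<in> carrier A. d (k \<odot>\<^bsub>A\<^esub> a) = k \<odot>\<^bsub>A\<^esub> d a) \<and>
        (\<forall>a \<in> carrier A. \<forall>b \<in> carrier A. d (a \<otimes>\<^bsub>A\<^esub> b) = a \<otimes>\<^bsub>A\<^esub> d b \<oplus>\<^bsub>A\<^esub> d a \<otimes>\<^bsub>A\<^esub> b)}"

text \<open>
  The \<open>A\<close>-module of derivations. The multiplication field of the record, which plays no role for
  modules, carries the commutator bracket; the field for the unit is meaningless.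
\<close>

definition Der :: "('k, 'm) ring_scheme \<Rightarrow> ('k, 'a, 'p) module_scheme \<Rightarrow> ('a, 'a \<Rightarrow> 'a) module" where
  "Der K A =
     \<lparr>carrier = derivations K A,
      mult = (\<lambda>d e. \<lambda>a\<in>carrier A. d (e a) \<ominus>\<^bsub>A\<^esub> e (d a)),
      one = undefined,
      zero = (\<lambda>a\<in>carrier A. \<zero>\<^bsub>A\<^esub>),
      add = (\<lambda>d e. \<lambda>a\<in>carrier A. d a \<oplus>\<^bsub>A\<^esub> e a),
      smult = (\<lambda>b d. \<lambda>a\<in>carrier A. b \<otimes>\<^bsub>A\<^esub> d a)\<rparr>"

lemma Der_module:
  assumes "algebra K A"
  shows "module A (Der K A)"
proof -
  interpret S: cring A using assms by (rule algebra.M_cring)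
  interpret algebra K A by fact
  have comm: "a \<otimes>\<^bsub>A\<^esub> (k \<odot>\<^bsub>A\<^esub> b) = k \<odot>\<^bsub>A\<^esub> (a \<otimes>\<^bsub>A\<^esub> b)"
    if "a \<in> carrier A" "b \<in> carrier A" "k \<in> carrier K" for a b k
    using that by (metis S.m_comm smult_assoc2 smult_closed)
  note D = Der_def derivations_def
  show ?thesis
  proof (rule moduleI)
    show "cring A" by (rule M_cring)
    show "abelian_group (Der K A)"
    proof (rule abelian_groupI)
      fix x y assume "x \<in> carrier (Der K A)" "y \<in> carrier (Der K A)"
      then show "x \<oplus>\<^bsub>Der K A\<^esub> y \<in> carrier (Der K A)"
        by (auto simp: D PiE_iff smult_r_distr S.l_distr S.r_distr S.add.m_ac)
    next
      fix x assume x: "x \<in> carrier (Der K A)"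
      show "\<exists>y\<in>carrier (Der K A). y \<oplus>\<^bsub>Der K A\<^esub> x = \<zero>\<^bsub>Der K A\<^esub>"
        using x
        by (intro bexI[of _ "\<lambda>a\<in>carrier A. \<ominus>\<^bsub>A\<^esub> x a"])
          (auto simp: D PiE_iff smult_r_minus S.minus_add S.l_minus S.r_minus S.l_neg S.r_neg S.a_comm
            intro!: restrict_ext)
    qed (auto simp: D PiE_iff S.add.m_ac fun_eq_iff extensional_def restrict_def)
  qed (auto simp: D PiE_iff smult_assoc2 comm S.l_distr S.r_distr S.m_ac smult_r_distr fun_eq_iff extensional_def restrict_def S.add.m_ac)
qed

text \<open>The \<open>K\<close>-module underlying an \<open>A\<close>-module, along the structure map \<open>k \<mapsto> k \<cdot> 1\<close> of the algebra.\<close>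

definition restrict_scalars ::
  "('k, 'a, 'p) module_scheme \<Rightarrow> ('a, 'l, 'q) module_scheme \<Rightarrow> ('k, 'l) module" where
  "restrict_scalars A L =
     \<lparr>carrier = carrier L, mult = mult L, one = one L, zero = zero L, add = add L,
      smult = (\<lambda>k x. (k \<odot>\<^bsub>A\<^esub> \<one>\<^bsub>A\<^esub>) \<odot>\<^bsub>L\<^esub> x)\<rparr>"

locale n_Lie_algebra =
  fixes n :: nat and K :: "('k, 'm) ring_scheme" and V :: "('k, 'l, 'p) module_scheme"
    and br :: "'l list \<Rightarrow> 'l"
  assumes field: "field K"
    and vector_space: "module K V"
    and bracket: "alternating_multilinear K V V n br"
    and Filippov: "\<lbrakk>xs \<in> tuples (n - 1) (carrier V); ys \<in> tuples n (carrier V)\<rbrakk> \<Longrightarrow>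
      br (xs @ [br ys]) = (\<Oplus>\<^bsub>V\<^esub>i\<in>{..<n}. br (ys[i := br (xs @ [ys ! i])]))"

text \<open>
  The anchor is given as an alternating multilinear map on representatives. In the axiom
  \<open>anchor_bracket\<close> the sum is the value of the anchor at
  \<open>X \<circ> Y = \<Sum>\<^sub>i y\<^sub>1 \<and> \<dots> \<and> [X, y\<^sub>i] \<and> \<dots> \<and> y\<^sub>n\<^sub>-\<^sub>1\<close>.
\<close>

locale n_Lie_Rinehart =
  fixes n :: nat and K :: "('k, 'm) ring_scheme" and A :: "('k, 'a, 'p) module_scheme"
    and L :: "('a, 'l, 'q) module_scheme"
    and br :: "'l list \<Rightarrow> 'l" and \<rho> :: "'l list \<Rightarrow> 'a \<Rightarrow> 'a"
  assumes algebra: "algebra K A"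
    and module: "module A L"
    and n_Lie: "n_Lie_algebra n K (restrict_scalars A L) br"
    and anchor: "alternating_multilinear A L (Der K A) (n - 1) \<rho>"
    and anchor_bracket: "\<lbrakk>X \<in> tuples (n - 1) (carrier L); Y \<in> tuples (n - 1) (carrier L)\<rbrakk> \<Longrightarrow>
      \<rho> X \<otimes>\<^bsub>Der K A\<^esub> \<rho> Y = (\<Oplus>\<^bsub>Der K A\<^esub>i\<in>{..<n - 1}. \<rho> (Y[i := br (X @ [Y ! i])]))"
    and Leibniz: "\<lbrakk>X \<in> tuples (n - 1) (carrier L); y \<in> carrier L; a \<in> carrier A\<rbrakk> \<Longrightarrow>
      br (X @ [a \<odot>\<^bsub>L\<^esub> y]) = a \<odot>\<^bsub>L\<^esub> br (X @ [y]) \<oplus>\<^bsub>L\<^esub> \<rho> X a \<odot>\<^bsub>L\<^esub> y"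

definition anchor_radical ::
  "nat \<Rightarrow> ('k, 'm) ring_scheme \<Rightarrow> ('k, 'a, 'p) module_scheme \<Rightarrow> ('a, 'l, 'q) module_scheme
    \<Rightarrow> ('l list \<Rightarrow> 'a \<Rightarrow> 'a) \<Rightarrow> 'l set" where
  "anchor_radical n K A L \<rho> =
     {u \<in> carrier L. \<forall>xs \<in> tuples (n - 2) (carrier L). \<rho> (u # xs) = \<zero>\<^bsub>Der K A\<^esub>}"

definition orthogonality_defect ::
  "('a, 'p) ring_scheme \<Rightarrow> ('l list \<Rightarrow> 'l) \<Rightarrow> ('l list \<Rightarrow> 'a \<Rightarrow> 'a) \<Rightarrow> ('l \<Rightarrow> 'l \<Rightarrow> 'a)
    \<Rightarrow> 'l list \<Rightarrow> 'l \<Rightarrow> 'l \<Rightarrow> 'a" where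
  "orthogonality_defect A br \<rho> B X u v =
     \<rho> X (B u v) \<ominus>\<^bsub>A\<^esub> B (br (X @ [u])) v \<ominus>\<^bsub>A\<^esub> B u (br (X @ [v]))"

definition scale_entry :: "('a, 'l, 'q) module_scheme \<Rightarrow> nat \<Rightarrow> 'a \<Rightarrow> 'l list \<Rightarrow> 'l list" where
  "scale_entry L i a X = X[i - 1 := a \<odot>\<^bsub>L\<^esub> X ! (i - 1)]"

definition linearity_obstruction ::
  "('a, 'p) ring_scheme \<Rightarrow> ('a, 'l, 'q) module_scheme \<Rightarrow> ('l list \<Rightarrow> 'l) \<Rightarrow> ('l list \<Rightarrow> 'a \<Rightarrow> 'a)
    \<Rightarrow> ('l \<Rightarrow> 'l \<Rightarrow> 'a) \<Rightarrow> nat \<Rightarrow> 'a \<Rightarrow> 'l list \<Rightarrow> 'l \<Rightarrow> 'l \<Rightarrow> 'a" where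
  "linearity_obstruction A L br \<rho> B i a X u v =
     orthogonality_defect A br \<rho> B (scale_entry L i a X) u v
       \<ominus>\<^bsub>A\<^esub> a \<otimes>\<^bsub>A\<^esub> orthogonality_defect A br \<rho> B X u v"

end

theory Submission
  imports Defs
begin

text \<open>
  Exchanging the entry in place \<open>i\<close> with the last entry moves a coefficient of \<open>x\<^sub>i\<close> to the last
  place, where the Leibniz rule applies: \<open>[X\<^sub>a\<^sub>,\<^sub>i, u] = a [X, u] - \<rho>(X') (a) x\<^sub>i\<close>, where \<open>X'\<close> is \<open>X\<close>
  with \<open>x\<^sub>i\<close> replaced by \<open>u\<close>. If \<open>u\<close> lies in the anchor radical, then \<open>\<rho>(X') = 0\<close>, so all three
  terms of the orthogonality defect are \<open>A\<close>-linear in the \<open>i\<close>-th entry of \<open>X\<close>.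
\<close>

lemma list_update_in_tuples:
  "\<lbrakk>xs \<in> tuples m S; x \<in> S\<rbrakk> \<Longrightarrow> xs[i := x] \<in> tuples m S"
  unfolding tuples_def using set_update_subset_insert by fastforce

lemma snoc_in_tuples:
  "\<lbrakk>xs \<in> tuples m S; x \<in> S\<rbrakk> \<Longrightarrow> xs @ [x] \<in> tuples (Suc m) S"
  by (auto simp: tuples_def)

lemma nth_tuples:
  "\<lbrakk>xs \<in> tuples m S; i < m\<rbrakk> \<Longrightarrow> xs ! i \<in> S"
  by (auto simp: tuples_def)

lemma alternating_multilinear_closed:
  "\<lbrakk>alternating_multilinear R M N m f; xs \<in> tuples m (carrier M)\<rbrakk> \<Longrightarrow> f xs \<in> carrier N"
  by (auto simp: alternating_multilinear_def)

lemma alternating_multilinear_add: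
  "\<lbrakk>alternating_multilinear R M N m f; xs \<in> tuples m (carrier M); i < m;
    x \<in> carrier M; y \<in> carrier M\<rbrakk> \<Longrightarrow>
   f (xs[i := x \<oplus>\<^bsub>M\<^esub> y]) = f (xs[i := x]) \<oplus>\<^bsub>N\<^esub> f (xs[i := y])"
  by (simp add: alternating_multilinear_def)

lemma alternating_multilinear_smult:
  "\<lbrakk>alternating_multilinear R M N m f; xs \<in> tuples m (carrier M); i < m;
    r \<in> carrier R; x \<in> carrier M\<rbrakk> \<Longrightarrow>
   f (xs[i := r \<odot>\<^bsub>M\<^esub> x]) = r \<odot>\<^bsub>N\<^esub> f (xs[i := x])"
  by (simp add: alternating_multilinear_def)

lemma alternating_multilinear_eq_entries:
  "\<lbrakk>alternating_multilinear R M N m f; xs \<in> tuples m (carrier M); i < m; j < m;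
    i \<noteq> j; xs ! i = xs ! j\<rbrakk> \<Longrightarrow> f xs = \<zero>\<^bsub>N\<^esub>"
  by (auto simp: alternating_multilinear_def)

text \<open>Polarization: putting \<open>x \<oplus> y\<close> in both places gives zero because the
  entries agree. In the expansion the two terms with a repeated entry vanish, and the two mixed
  terms remain.\<close>

lemma alternating_multilinear_swap:
  assumes f: "alternating_multilinear R M N m f"
    and M: "abelian_group M" and N: "abelian_group N"
    and xs: "xs \<in> tuples m (carrier M)" and ij: "i < m" "j < m" "i \<noteq> j"
    and x: "x \<in> carrier M" and y: "y \<in> carrier M"
  shows "f (xs[i := x, j := y]) \<oplus>\<^bsub>N\<^esub> f (xs[i := y, j := x]) = \<zero>\<^bsub>N\<^esub>"
proof -
  interpret M: abelian_group M by fact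
  interpret N: abelian_group N by fact
  let ?g = "\<lambda>x y. f (xs[i := x, j := y])"
  let ?s = "x \<oplus>\<^bsub>M\<^esub> y"
  have len: "length xs = m" using xs by (simp add: tuples_def)
  have closed: "?g z w \<in> carrier N" if "z \<in> carrier M" "w \<in> carrier M" for z w
    using that xs by (intro alternating_multilinear_closed[OF f] list_update_in_tuples)
  have diag: "?g z z = \<zero>\<^bsub>N\<^esub>" if "z \<in> carrier M" for z
    using that xs ij len
    by (intro alternating_multilinear_eq_entries[OF f, of _ i j] list_update_in_tuples) auto
  have add_right: "?g z ?s = ?g z x \<oplus>\<^bsub>N\<^esub> ?g z y" if "z \<in> carrier M" for z
    using that xs ij x y by (intro alternating_multilinear_add[OF f] list_update_in_tuples)
  \<comment> \<open>Additivity speaks of the outermost update, so the updates in places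
    \<open>i\<close> and \<open>j\<close>, which are distinct, are interchanged first.\<close>
  have add_left: "?g ?s z = ?g x z \<oplus>\<^bsub>N\<^esub> ?g y z" if "z \<in> carrier M" for z
    using alternating_multilinear_add[OF f list_update_in_tuples[OF xs that] ij(1) x y, of j] ij
    by (simp add: list_update_swap)
  have "\<zero>\<^bsub>N\<^esub> = ?g ?s ?s" using x y by (simp add: diag)
  also have "\<dots> = ?g x ?s \<oplus>\<^bsub>N\<^esub> ?g y ?s" using x y by (simp only: add_left M.a_closed)
  also have "\<dots> = ?g x y \<oplus>\<^bsub>N\<^esub> ?g y x" using x y by (simp add: add_right diag closed)
  finally show ?thesis by simp
qed

text \<open>The radical is defined through the first argument of the anchor; exchanging places
  \<open>0\<close> and \<open>i\<close> carries the vanishing over to any other argument.\<close>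

lemma anchor_update_radical:
  assumes "n_Lie_Rinehart n K A L br \<rho>" and u: "u \<in> anchor_radical n K A L \<rho>"
    and X: "X \<in> tuples (n - 1) (carrier L)" and i: "i < n - 1"
  shows "\<rho> (X[i := u]) = \<zero>\<^bsub>Der K A\<^esub>"
proof -
  interpret n_Lie_Rinehart n K A L br \<rho> by fact
  interpret L: module A L by (rule module)
  interpret D: module A "Der K A" by (rule Der_module) (rule algebra)
  have uL: "u \<in> carrier L" using u by (simp add: anchor_radical_def)
  have first: "\<rho> (Y[0 := u]) = \<zero>\<^bsub>Der K A\<^esub>" if Y: "Y \<in> tuples (n - 1) (carrier L)" for Y
  proof -
    \<comment> \<open>The bound on \<open>i\<close> forces \<open>n - 1 > 0\<close>, so
      \<open>Y\<close> is nonempty.\<close>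
    obtain y ys where "Y = y # ys" using Y i by (cases Y) (auto simp: tuples_def)
    moreover from this have "ys \<in> tuples (n - 2) (carrier L)" using Y by (auto simp: tuples_def)
    ultimately show ?thesis using u by (simp add: anchor_radical_def)
  qed
  show ?thesis
  proof (cases "i = 0")
    case True
    then show ?thesis using first X by simp
  next
    case False
    let ?x = "X ! 0"
    have x: "?x \<in> carrier L" using X i by (intro nth_tuples) auto
    \<comment> \<open>Writing the entry \<open>?x\<close> back into place \<open>0\<close> leaves
      \<open>X\<close> unchanged and gives \<open>X[i := u]\<close> the shape needed for the
      exchange.\<close>
    have "\<rho> (X[0 := ?x, i := u]) \<oplus>\<^bsub>Der K A\<^esub> \<rho> (X[0 := u, i := ?x]) = \<zero>\<^bsub>Der K A\<^esub>"
      using False i X x uL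
      by (intro alternating_multilinear_swap[OF anchor] L.abelian_group_axioms
          D.abelian_group_axioms) auto
    moreover have "\<rho> (X[0 := u, i := ?x]) = \<zero>\<^bsub>Der K A\<^esub>"
      using first[OF list_update_in_tuples[OF X x]] False
      by (simp add: list_update_swap[of 0 i])
    moreover have "\<rho> (X[i := u]) \<in> carrier (Der K A)"
      using X uL by (intro alternating_multilinear_closed[OF anchor] list_update_in_tuples)
    ultimately show ?thesis by simp
  qed
qed

text \<open>The bracket is multilinear over \<open>K\<close> only, so a coefficient from
  \<open>A\<close> in place \<open>i\<close> has to be handled by the Leibniz rule. For
  \<open>u\<close> in the radical the correction term disappears.\<close>

lemma bracket_scale_entry_radical:
  assumes "n_Lie_Rinehart n K A L br \<rho>" and u: "u \<in> anchor_radical n K A L \<rho>"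
    and X: "X \<in> tuples (n - 1) (carrier L)" and i: "i < n - 1" and a: "a \<in> carrier A"
  shows "br (X[i := a \<odot>\<^bsub>L\<^esub> X ! i] @ [u]) = a \<odot>\<^bsub>L\<^esub> br (X @ [u])"
proof -
  interpret n_Lie_Rinehart n K A L br \<rho> by fact
  interpret L: module A L by (rule module)
  interpret V: n_Lie_algebra n K "restrict_scalars A L" br by (rule n_Lie)
  interpret V: module K "restrict_scalars A L" by (rule V.vector_space)
  \<comment> \<open>Restriction of scalars keeps the additive group, so antisymmetry of the bracket
    over \<open>K\<close> can be read in \<open>L\<close>.\<close>
  have V_simps: "carrier (restrict_scalars A L) = carrier L"
    "add (restrict_scalars A L) = add L" "zero (restrict_scalars A L) = zero L"
    by (simp_all add: restrict_scalars_def)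
  have uL: "u \<in> carrier L" using u by (simp add: anchor_radical_def)
  have len: "length X = n - 1" using X by (simp add: tuples_def)
  let ?x = "X ! i"
  have x: "?x \<in> carrier L" using X i by (rule nth_tuples)
  have closed: "br (Y @ [y]) \<in> carrier L"
    if "Y \<in> tuples (n - 1) (carrier L)" "y \<in> carrier L" for Y y
    using alternating_multilinear_closed[OF V.bracket] snoc_in_tuples[OF that] i
    by (simp add: V_simps)
  have swap: "br (X[i := y] @ [u]) \<oplus>\<^bsub>L\<^esub> br (X[i := u] @ [y]) = \<zero>\<^bsub>L\<^esub>"
    if y: "y \<in> carrier L" for y
  proof -
    have "X @ [u] \<in> tuples n (carrier (restrict_scalars A L))"
      using snoc_in_tuples[OF X uL] i by (simp add: V_simps)
    \<comment> \<open>Counting from zero, \<open>n - 1\<close> is the last place of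
      \<open>X @ [u]\<close>, and it differs from \<open>i\<close> since
      \<open>i < n - 1\<close>.\<close>
    from alternating_multilinear_swap[OF V.bracket V.abelian_group_axioms V.abelian_group_axioms
        this, of i "n - 1" y u]
    show ?thesis using i len y uL by (simp add: V_simps list_update_append)
  qed
  let ?s = "br (X @ [u])" and ?r = "br (X[i := u] @ [?x])"
  have Xu: "X[i := u] \<in> tuples (n - 1) (carrier L)"
    using X uL by (rule list_update_in_tuples)
  have r: "?r \<in> carrier L" using Xu x by (rule closed)
  have s: "?s \<in> carrier L" using X uL by (rule closed)
  have "br (X[i := u] @ [a \<odot>\<^bsub>L\<^esub> ?x]) = a \<odot>\<^bsub>L\<^esub> ?r \<oplus>\<^bsub>L\<^esub> \<rho> (X[i := u]) a \<odot>\<^bsub>L\<^esub> ?x"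
    using Xu x a by (rule Leibniz)
  also have "\<rho> (X[i := u]) a = \<zero>\<^bsub>A\<^esub>"
    using anchor_update_radical[OF assms(1) u X i] a by (simp add: Der_def)
  finally have q: "br (X[i := u] @ [a \<odot>\<^bsub>L\<^esub> ?x]) = a \<odot>\<^bsub>L\<^esub> ?r"
    using a r x by simp
  \<comment> \<open>Both sides of the claim are shown to be additive inverses of the same element,
    \<open>a\<close> times \<open>?r\<close>: the left side by the exchange for \<open>a\<close>
    times \<open>?x\<close>, the right side by \<open>a\<close> times the exchange for
    \<open>?x\<close>, where \<open>X[i := ?x]\<close> is \<open>X\<close>.\<close>
  have "br (X[i := a \<odot>\<^bsub>L\<^esub> ?x] @ [u]) \<oplus>\<^bsub>L\<^esub> a \<odot>\<^bsub>L\<^esub> ?r = \<zero>\<^bsub>L\<^esub>"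
    using swap[of "a \<odot>\<^bsub>L\<^esub> ?x"] a x by (simp add: q)
  moreover have "a \<odot>\<^bsub>L\<^esub> ?s \<oplus>\<^bsub>L\<^esub> a \<odot>\<^bsub>L\<^esub> ?r = \<zero>\<^bsub>L\<^esub>"
    using swap[OF x] a r s by (simp flip: L.smult_r_distr)
  moreover have "br (X[i := a \<odot>\<^bsub>L\<^esub> ?x] @ [u]) \<in> carrier L"
    using X x uL a by (intro closed list_update_in_tuples) auto
  ultimately show ?thesis
    using a r s by (metis L.add.inv_equality L.add.inv_inv L.smult_closed L.minus_equality)
qed

theorem corollary4p12:
  fixes n :: nat
    and K :: "('k, 'm) ring_scheme"
    and A :: "('k, 'a, 'p) module_scheme"
    and L :: "('a, 'l, 'q) module_scheme"
    and br :: "'l list \<Rightarrow> 'l"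
    and \<rho> :: "'l list \<Rightarrow> 'a \<Rightarrow> 'a"
    and B :: "'l \<Rightarrow> 'l \<Rightarrow> 'a"
  assumes "field K" and "char_zero K" and "algebra K A" and "n \<ge> 2"
    and "n_Lie_Rinehart n K A L br \<rho>"
    and "symmetric_bilinear_form A L B"
    and "u \<in> anchor_radical n K A L \<rho>" and "v \<in> anchor_radical n K A L \<rho>"
  shows "\<forall>X \<in> tuples (n - 1) (carrier L). \<forall>i \<in> {1..n - 1}. \<forall>a \<in> carrier A.
    linearity_obstruction A L br \<rho> B i a X u v = \<zero>\<^bsub>A\<^esub>"
proof (intro ballI)
  fix X i a
  assume X: "X \<in> tuples (n - 1) (carrier L)" and "i \<in> {1..n - 1}" and a: "a \<in> carrier A"
  \<comment> \<open>The index \<open>i\<close> counts from one, list positions from zero.\<close>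
  then have i: "i - 1 < n - 1" by auto
  interpret n_Lie_Rinehart n K A L br \<rho> by fact
  interpret L: module A L by (rule module)
  interpret V: n_Lie_algebra n K "restrict_scalars A L" br by (rule n_Lie)
  have u: "u \<in> carrier L" and v: "v \<in> carrier L"
    using assms(7,8) by (auto simp: anchor_radical_def)
  have B: "B y z \<in> carrier A" "B (a \<odot>\<^bsub>L\<^esub> y) z = a \<otimes>\<^bsub>A\<^esub> B y z" "B y (a \<odot>\<^bsub>L\<^esub> z) = a \<otimes>\<^bsub>A\<^esub> B y z"
    if "y \<in> carrier L" "z \<in> carrier L" for y z
    using assms(6) that a by (auto simp: symmetric_bilinear_form_def)
  have br: "br (X @ [y]) \<in> carrier L" if "y \<in> carrier L" for y
    using alternating_multilinear_closed[OF V.bracket] snoc_in_tuples[OF X that] \<open>n \<ge> 2\<close>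
    by (simp add: restrict_scalars_def)
  have "\<rho> X \<in> derivations K A"
    using alternating_multilinear_closed[OF anchor X] by (simp add: Der_def)
  then have rho: "\<rho> X (B u v) \<in> carrier A"
    using B(1)[OF u v] by (auto simp: derivations_def)
  \<comment> \<open>Unlike the bracket, the anchor is multilinear over \<open>A\<close>, so the
    coefficient comes out without a correction.\<close>
  have "\<rho> (scale_entry L i a X) = a \<odot>\<^bsub>Der K A\<^esub> \<rho> X"
    using alternating_multilinear_smult[OF anchor X i a nth_tuples[OF X i]]
    by (simp add: scale_entry_def)
  then have "\<rho> (scale_entry L i a X) (B u v) = a \<otimes>\<^bsub>A\<^esub> \<rho> X (B u v)"
    using B(1)[OF u v] by (simp add: Der_def)
  \<comment> \<open>The defect contains one bracket ending in \<open>u\<close> and one ending in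
    \<open>v\<close>; each loses its correction term because its last entry lies in the
    radical.\<close>
  moreover have "br (scale_entry L i a X @ [w]) = a \<odot>\<^bsub>L\<^esub> br (X @ [w])" if "w \<in> {u, v}" for w
    unfolding scale_entry_def
    using that assms(7,8) by (intro bracket_scale_entry_radical[OF assms(5) _ X i a]) auto
  ultimately have "orthogonality_defect A br \<rho> B (scale_entry L i a X) u v =
      a \<otimes>\<^bsub>A\<^esub> orthogonality_defect A br \<rho> B X u v"
    using a u v B br rho
    by (simp add: orthogonality_defect_def a_minus_def L.R.r_distr L.R.r_minus)
  \<comment> \<open>The obstruction is now a difference of two equal elements; the closure facts
    place them in \<open>A\<close>, where it cancels.\<close>
  then show "linearity_obstruction A L br \<rho> B i a X u v = \<zero>\<^bsub>A\<^esub>"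
    using a u v B(1) br rho
    by (simp add: linearity_obstruction_def orthogonality_defect_def a_minus_def L.R.r_neg)
qed

end
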